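(* Let $H=(Q^0,Q^1,\delta^0,\delta^1,q_0)$ be a two-player game graph, $Q=Q^0\cup Q^1$, $F_{\mathcal A},F_{\mathcal G}\subseteq Q$, $\mathcal F_{\mathcal A}=\{F_{\mathcal A}\}$, $\mathcal F_{\mathcal G}=\{F_{\mathcal G}\}$, and $$\varphi_4=\nu Z.\,\mu Y.\,\nu X.\,\mu W.\;\big(F_{\mathcal G}\cap \mathrm{Pre}^1(Z)\big)\cup \mathrm{Pre}^1(Y)\cup\big((Q\setminus F_{\mathcal A})\cap \mathrm{CPre}(W,\,X\setminus F_{\mathcal A})\big).$$ Then for every $q\in Q\setminus[\![\varphi_4]\!]$ and every system strategy $f^1$ over $H$, at least one of the following fails: (i) $\emptyset\neq\mathcal L_q(H,f^1)\subseteq\overline{\mathcal L_q(H,\mathcal F_{\mathcal A})}\cup\mathcal L_q(H,\mathcal F_{\mathcal G})$; (ii) $\mathrm{pre}(\mathcal L_q(H,f^1))=\mathrm{pre}\big(\mathcal L_q(H,f^1)\cap\mathcal L_q(H,\mathcal F_{\mathcal A})\big)$.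
   Context: A two-player game graph $H=(Q^0,Q^1,\delta^0,\delta^1,q_0)$ has finite disjoint state sets $Q^0$ (environment) and $Q^1$ (system), transition functions $\delta^0:Q^0\to 2^{Q^1}$, $\delta^1:Q^1\to 2^{Q^0}$, $q_0\in Q^0$. A play from $q\in Q$ is an infinite state sequence starting at $q$ following $\delta^0$ from $Q^0$-states and $\delta^1$ from $Q^1$-states. A system strategy maps finite play prefixes ending in $Q^1$ to states of $Q^0$; $\mathcal L_q(H,f^1)$ is the set of plays from $q$ whose system moves follow $f^1$. For a family $\mathcal F$ of subsets of $Q$, $\mathcal L_q(H,\mathcal F)$ is the set of plays from $q$ visiting every set of $\mathcal F$ infinitely often; $\overline{\mathcal L}$ is complement among infinite sequences; $\mathrm{pre}(\mathcal L)$ is the set of finite prefixes of words in $\mathcal L$. For $P,P'\subseteq Q$: $\mathrm{Pre}^{\exists}(P)=\{q\in Q^0:\delta^0(q)\cap P\neq\emptyset\}\cup\{q\in Q^1:\delta^1(q)\cap P\neq\emptyset\}$, $\mathrm{Pre}^1(P)=\{q\in Q^0:\delta^0(q)\subseteq P\}\cup\{q\in Q^1:\delta^1(q)\cap P\neq\emptyset\}$, $\mathrm{CPre}(P,P')=\mathrm{Pre}^{\exists}(P)\cap\mathrm{Pre}^1(P\cup P')$; $\mu,\nu$ are least/greatest fixpoints and $[\![\cdot]\!]$ is the set of states a formula evaluates to.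
   Formalization: System strategies are required to choose legal moves (in δ¹ of the last state) after every finite play prefix from q that follows the strategy; if illegal moves were allowed, the claim would be false, since they silently discard unwanted plays. *)

theory Defs
  imports Main "HOL-Library.Infinite_Set" "HOL-Library.Omega_Words_Fun"
begin

section \<open>Two-player game graphs\<close>

record 'q game_graph =
  env_states :: "'q set"
  sys_states :: "'q set"
  env_trans :: "'q \<Rightarrow> 'q set"
  sys_trans :: "'q \<Rightarrow> 'q set"
  init :: "'q"

definition wf_game_graph :: "'q game_graph \<Rightarrow> bool" where
  "wf_game_graph H \<longleftrightarrow>
     finite (env_states H) \<and> finite (sys_states H) \<and>
     env_states H \<inter> sys_states H = {} \<and>
     (\<forall>q \<in> env_states H. env_trans H q \<subseteq> sys_states H) \<and>
     (\<forall>q \<in> sys_states H. sys_trans H q \<subseteq> env_states H) \<and>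
     init H \<in> env_states H"

definition states :: "'q game_graph \<Rightarrow> 'q set" where
  "states H = env_states H \<union> sys_states H"

definition edge :: "'q game_graph \<Rightarrow> 'q \<Rightarrow> 'q \<Rightarrow> bool" where
  "edge H q q' \<longleftrightarrow>
     (q \<in> env_states H \<and> q' \<in> env_trans H q) \<or>
     (q \<in> sys_states H \<and> q' \<in> sys_trans H q)"

section \<open>Plays and languages\<close>

definition omega_words :: "'q game_graph \<Rightarrow> 'q word set" where
  "omega_words H = {\<pi>. range \<pi> \<subseteq> states H}"

definition plays :: "'q game_graph \<Rightarrow> 'q \<Rightarrow> 'q word set" where
  "plays H q = {\<pi> \<in> omega_words H. \<pi> 0 = q \<and> (\<forall>k. edge H (\<pi> k) (\<pi> (Suc k)))}"

definition play_prefixes :: "'q game_graph \<Rightarrow> 'q \<Rightarrow> 'q list set" where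
  "play_prefixes H q =
     {\<rho>. \<rho> \<noteq> [] \<and> set \<rho> \<subseteq> states H \<and> hd \<rho> = q \<and>
         (\<forall>k. Suc k < length \<rho> \<longrightarrow> edge H (\<rho> ! k) (\<rho> ! Suc k))}"

definition compliant_prefixes ::
    "'q game_graph \<Rightarrow> 'q \<Rightarrow> ('q list \<Rightarrow> 'q) \<Rightarrow> 'q list set" where
  "compliant_prefixes H q f =
     {\<rho> \<in> play_prefixes H q.
        \<forall>k. Suc k < length \<rho> \<longrightarrow> \<rho> ! k \<in> sys_states H \<longrightarrow> \<rho> ! Suc k = f (take (Suc k) \<rho>)}"

text \<open>
  A system strategy has to choose a legal move after every finite play prefix from \<open>q\<close> that
  follows the strategy and ends in a system state; its values on all other lists are irrelevant.
  Legality matters: otherwise the system could discard unwanted plays by an illegal move,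
  since such plays would simply be missing from the (infinite) plays following the strategy.
  It is demanded only along the strategy so that system states without successors elsewhere in
  the graph do not exclude a strategy; a strategy that is legal everywhere is covered by
  \<open>system_strategyI\<close> below.
\<close>

definition system_strategy :: "'q game_graph \<Rightarrow> 'q \<Rightarrow> ('q list \<Rightarrow> 'q) \<Rightarrow> bool" where
  "system_strategy H q f \<longleftrightarrow>
     (\<forall>\<rho> \<in> compliant_prefixes H q f. last \<rho> \<in> sys_states H \<longrightarrow> f \<rho> \<in> sys_trans H (last \<rho>))"

lemma system_strategyI:
  assumes "\<And>\<rho>. \<rho> \<in> play_prefixes H q \<Longrightarrow> last \<rho> \<in> sys_states H \<Longrightarrow> f \<rho> \<in> sys_trans H (last \<rho>)"
  shows "system_strategy H q f"
  using assms by (auto simp: system_strategy_def compliant_prefixes_def)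

definition strategy_lang :: "'q game_graph \<Rightarrow> 'q \<Rightarrow> ('q list \<Rightarrow> 'q) \<Rightarrow> 'q word set" where
  "strategy_lang H q f =
     {\<pi> \<in> plays H q. \<forall>k. \<pi> k \<in> sys_states H \<longrightarrow> \<pi> (Suc k) = f (prefix (Suc k) \<pi>)}"

definition buchi_lang :: "'q game_graph \<Rightarrow> 'q \<Rightarrow> 'q set set \<Rightarrow> 'q word set" where
  "buchi_lang H q \<F> = {\<pi> \<in> plays H q. \<forall>F \<in> \<F>. \<exists>\<^sub>\<infinity>k. \<pi> k \<in> F}"

definition pre :: "'q word set \<Rightarrow> 'q list set" where
  "pre L = {prefix n \<pi> | n \<pi>. \<pi> \<in> L}"

section \<open>Predecessor operators and the fixpoint\<close>

definition Pre_ex :: "'q game_graph \<Rightarrow> 'q set \<Rightarrow> 'q set" where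
  "Pre_ex H P =
     {q \<in> env_states H. env_trans H q \<inter> P \<noteq> {}} \<union> {q \<in> sys_states H. sys_trans H q \<inter> P \<noteq> {}}"

definition Pre_sys :: "'q game_graph \<Rightarrow> 'q set \<Rightarrow> 'q set" where
  "Pre_sys H P =
     {q \<in> env_states H. env_trans H q \<subseteq> P} \<union> {q \<in> sys_states H. sys_trans H q \<inter> P \<noteq> {}}"

definition CPre :: "'q game_graph \<Rightarrow> 'q set \<Rightarrow> 'q set \<Rightarrow> 'q set" where
  "CPre H P P' = Pre_ex H P \<inter> Pre_sys H (P \<union> P')"

text \<open>
  The body is monotone in each variable and always a subset of \<open>states H\<close>, so the fixpoints in
  the lattice of all sets over \<open>'q\<close> are those in the lattice of subsets of \<open>states H\<close>.
\<close>

definition phi4 :: "'q game_graph \<Rightarrow> 'q set \<Rightarrow> 'q set \<Rightarrow> 'q set" where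
  "phi4 H F\<^sub>A F\<^sub>G =
     gfp (\<lambda>Z. lfp (\<lambda>Y. gfp (\<lambda>X. lfp (\<lambda>W.
       (F\<^sub>G \<inter> Pre_sys H Z) \<union> Pre_sys H Y \<union> ((states H - F\<^sub>A) \<inter> CPre H W (X - F\<^sub>A))))))"

end

theory Submission
  imports Defs
begin

text \<open>
  Assume (i) and (ii), and let \<open>N\<close> be the set of states in which some finite prefix following \<open>f\<close>
  ends. Then \<open>N\<close> is a post-fixpoint of the outermost operator, hence \<open>N \<subseteq> \<lbrakk>\<phi>\<^sub>4\<rbrakk>\<close>, although
  \<open>q \<in> N\<close>. For let \<open>Y\<close> be the value of the \<open>\<mu>Y\<close> formula at \<open>Z = N\<close>, and suppose that a prefix
  ends outside \<open>Y\<close>. From there the environment can always stay outside \<open>Y\<close>; no state of \<open>F\<^sub>G\<close> is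
  met on the way, since in such a state the environment could leave \<open>N\<close>. It can also reach \<open>F\<^sub>A\<close>:
  let \<open>B\<close> be the set of states outside \<open>Y\<close> where some prefix ends from which it cannot. A prefix
  witnessing a state of \<open>B\<close> outside the \<open>\<mu>W\<close> formula at \<open>X = B \<union> Y\<close> extends by (ii) to a play
  visiting \<open>F\<^sub>A\<close>. Failure of \<open>CPre\<close> along this play means that it stays outside that formula, and so
  outside \<open>Y\<close>, or that the environment can move into \<open>F\<^sub>A\<close> or out of \<open>B\<close>; in every case \<open>F\<^sub>A\<close> is
  reached. So \<open>B \<subseteq> Y\<close> by coinduction, that is, \<open>B = {}\<close>. Reaching \<open>F\<^sub>A\<close> again and again yields
  a play that contradicts (i).
\<close>

section \<open>Compliant prefixes, their extensions and limits\<close>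

lemma compliant_prefixes_snoc:
  assumes "\<rho> \<in> compliant_prefixes H q f" "edge H (last \<rho>) t" "t \<in> states H"
    and "last \<rho> \<in> sys_states H \<Longrightarrow> t = f \<rho>"
  shows "\<rho> @ [t] \<in> compliant_prefixes H q f"
proof -
  have ne: "\<rho> \<noteq> []"
    using assms(1) by (auto simp: compliant_prefixes_def play_prefixes_def)
  have E: "edge H ((\<rho> @ [t]) ! k) ((\<rho> @ [t]) ! Suc k)" if "Suc k < length (\<rho> @ [t])" for k
  proof (cases "Suc k < length \<rho>")
    case True
    then show ?thesis
      using assms(1) by (auto simp: compliant_prefixes_def play_prefixes_def nth_append)
  next
    case False
    then have "Suc k = length \<rho>" using that by simp
    moreover from this have "\<rho> ! k = last \<rho>" using ne by (metis diff_Suc_1 last_conv_nth)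
    ultimately show ?thesis using assms(2) by (auto simp: nth_append)
  qed
  have F: "(\<rho> @ [t]) ! Suc k = f (take (Suc k) (\<rho> @ [t]))"
    if "Suc k < length (\<rho> @ [t])" "(\<rho> @ [t]) ! k \<in> sys_states H" for k
  proof (cases "Suc k < length \<rho>")
    case True
    then show ?thesis
      using assms(1) that by (auto simp: compliant_prefixes_def nth_append)
  next
    case False
    then have "Suc k = length \<rho>" using that by simp
    moreover from this have "\<rho> ! k = last \<rho>" using ne by (metis diff_Suc_1 last_conv_nth)
    ultimately show ?thesis using assms(4) that by (auto simp: nth_append)
  qed
  show ?thesis
    using assms(1,3) ne E F unfolding compliant_prefixes_def play_prefixes_def
    by simp
qed

lemma compliant_prefixes_last:
  assumes "\<rho> \<in> compliant_prefixes H q f"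
  shows "last \<rho> \<in> states H"
  using assms by (auto simp: compliant_prefixes_def play_prefixes_def)

lemma strategy_lang_prefix:
  assumes "\<pi> \<in> strategy_lang H q f"
  shows "prefix (Suc n) \<pi> \<in> compliant_prefixes H q f"
proof -
  have *: "take (Suc k) (prefix (Suc n) \<pi>) = prefix (Suc k) \<pi>" if "k \<le> n" for k
    using that by (simp add: min_def del: subseq_to_Suc)
  have "hd (prefix (Suc n) \<pi>) = \<pi> 0"
    by (simp add: subsequence_def hd_map upt_conv_Cons del: upt_Suc subseq_to_Suc)
  with assms * show ?thesis
    unfolding strategy_lang_def plays_def omega_words_def compliant_prefixes_def play_prefixes_def
    by (auto simp del: subseq_to_Suc)
qed

text \<open>Outside \<open>Pre_sys H T\<close> an environment state has a successor outside
  \<open>T\<close>, and a system state has none inside, so the legal move of \<open>f\<close> also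
  avoids \<open>T\<close>.\<close>

lemma not_Pre_sys_extend:
  assumes "wf_game_graph H" "system_strategy H q f"
    and \<rho>: "\<rho> \<in> compliant_prefixes H q f" and "last \<rho> \<notin> Pre_sys H T"
  obtains t where "t \<notin> T" "\<rho> @ [t] \<in> compliant_prefixes H q f"
proof (cases "last \<rho> \<in> sys_states H")
  case True
  then have "f \<rho> \<in> sys_trans H (last \<rho>)"
    using assms(2) \<rho> by (auto simp: system_strategy_def)
  moreover from this True have "f \<rho> \<in> states H"
    using assms(1) by (auto simp: wf_game_graph_def states_def)
  moreover have "f \<rho> \<notin> T"
    using assms(4) True calculation by (auto simp: Pre_sys_def)
  ultimately show ?thesis
    using True by (intro that compliant_prefixes_snoc[OF \<rho>]) (auto simp: edge_def)
next
  case False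
  then have env: "last \<rho> \<in> env_states H"
    using compliant_prefixes_last[OF \<rho>] by (auto simp: states_def)
  then obtain t where "t \<in> env_trans H (last \<rho>)" "t \<notin> T"
    using assms(4) by (auto simp: Pre_sys_def)
  moreover from this env have "t \<in> states H"
    using assms(1) by (auto simp: wf_game_graph_def states_def)
  ultimately show ?thesis
    using env False by (intro that compliant_prefixes_snoc[OF \<rho>]) (auto simp: edge_def)
qed

lemma compliant_limit:
  assumes C: "\<And>i. \<sigma> i \<in> compliant_prefixes H q f"
    and S: "\<And>i. \<exists>ys. ys \<noteq> [] \<and> \<sigma> (Suc i) = \<sigma> i @ ys"
  obtains \<pi> where "\<pi> \<in> strategy_lang H q f" "\<And>i. prefix (length (\<sigma> i)) \<pi> = \<sigma> i"
    "\<And>i. i < length (\<sigma> i)"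
proof -
  have len: "i < length (\<sigma> i)" for i
  proof (induction i)
    case 0
    then show ?case using C[of 0] by (auto simp: compliant_prefixes_def play_prefixes_def)
  next
    case (Suc i)
    obtain ys where "ys \<noteq> []" "\<sigma> (Suc i) = \<sigma> i @ ys" using S by blast
    with Suc show ?case by (cases ys) auto
  qed
  have ext: "\<exists>ys. \<sigma> (i + d) = \<sigma> i @ ys" for i d
  proof (induction d)
    case (Suc d)
    then show ?case using S[of "i + d"] by auto
  qed simp
  have nth_le: "\<sigma> j ! k = \<sigma> i ! k" if "i \<le> j" "k < length (\<sigma> i)" for i j k
    using ext[of i "j - i"] that by (auto simp: nth_append)
  \<comment> \<open>Diagonal choice: \<open>len\<close> guarantees that the entry with index
    \<open>n\<close> of \<open>\<sigma> n\<close> exists, and \<open>nth_le\<close> that later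
    members agree with it.\<close>
  define \<pi> where "\<pi> n = \<sigma> n ! n" for n
  have nth: "\<sigma> i ! k = \<pi> k" if "k < length (\<sigma> i)" for i k
    using nth_le[of i k k] nth_le[of k i k] len that unfolding \<pi>_def
    by (cases "i \<le> k") auto
  have pre: "prefix (length (\<sigma> i)) \<pi> = \<sigma> i" for i
    by (rule nth_equalityI) (auto simp: nth)
  have take: "take (Suc k) (\<sigma> (Suc k)) = prefix (Suc k) \<pi>" for k
    using len[of "Suc k"] by (intro nth_equalityI) (auto simp: nth simp del: subseq_to_Suc)
  have "\<pi> k \<in> states H" for k
    using C[of k] len[of k] unfolding \<pi>_def compliant_prefixes_def play_prefixes_def
    by (auto dest: nth_mem)
  moreover have "\<pi> 0 = q"
    using C[of 0] by (auto simp: \<pi>_def compliant_prefixes_def play_prefixes_def hd_conv_nth)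
  moreover have "edge H (\<pi> k) (\<pi> (Suc k))" for k
    using C[of "Suc k"] len[of "Suc k"] nth[of k "Suc k"] nth[of "Suc k" "Suc k"]
    by (auto simp: compliant_prefixes_def play_prefixes_def)
  moreover have "\<pi> (Suc k) = f (prefix (Suc k) \<pi>)" if "\<pi> k \<in> sys_states H" for k
    using C[of "Suc k"] len[of "Suc k"] nth[of k "Suc k"] nth[of "Suc k" "Suc k"] take[of k] that
    by (auto simp: compliant_prefixes_def simp del: subseq_to_Suc)
  ultimately have "\<pi> \<in> strategy_lang H q f"
    by (auto simp: strategy_lang_def plays_def omega_words_def)
  then show ?thesis using that pre len by blast
qed

text \<open>Dependent choice: iterating a nonempty extension inside \<open>P\<close> yields a play
  in the limit. \<open>R\<close> is guaranteed only from \<open>\<sigma> 1\<close> on, since the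
  start \<open>\<rho>\<close> need not satisfy it.\<close>

lemma compliant_chain:
  assumes \<rho>: "\<rho> \<in> P" and C: "P \<subseteq> compliant_prefixes H q f"
    and S: "\<And>\<rho>. \<rho> \<in> P \<Longrightarrow> \<exists>ys. ys \<noteq> [] \<and> \<rho> @ ys \<in> P \<and> R (\<rho> @ ys)"
  shows "\<exists>\<pi> \<in> strategy_lang H q f. \<exists>\<sigma>. \<sigma> 0 = \<rho> \<and>
    (\<forall>i. \<sigma> i \<in> P \<and> R (\<sigma> (Suc i)) \<and> prefix (length (\<sigma> i)) \<pi> = \<sigma> i \<and> i < length (\<sigma> i))"
proof -
  have "\<exists>\<sigma>. \<sigma> 0 = \<rho> \<and> (\<forall>i. \<sigma> i \<in> P \<and> ((\<exists>ys. ys \<noteq> [] \<and> \<sigma> (Suc i) = \<sigma> i @ ys) \<and> R (\<sigma> (Suc i))))"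
  proof -
    have "\<exists>\<rho>'. \<rho>' \<in> P \<and> (\<exists>ys. ys \<noteq> [] \<and> \<rho>' = \<rho> @ ys) \<and> R \<rho>'" if "\<rho> \<in> P" for \<rho>
      using S[OF that] by blast
    then obtain g where g: "\<And>\<rho>. \<rho> \<in> P \<Longrightarrow> g \<rho> \<in> P \<and> (\<exists>ys. ys \<noteq> [] \<and> g \<rho> = \<rho> @ ys) \<and> R (g \<rho>)"
      by metis
    have "(g ^^ i) \<rho> \<in> P" for i
      by (induction i) (use \<rho> g in auto)
    with g show ?thesis by (intro exI[of _ "\<lambda>i. (g ^^ i) \<rho>"]) auto
  qed
  then obtain \<sigma> where \<sigma>: "\<sigma> 0 = \<rho>" "\<And>i. \<sigma> i \<in> P"
    "\<And>i. \<exists>ys. ys \<noteq> [] \<and> \<sigma> (Suc i) = \<sigma> i @ ys" "\<And>i. R (\<sigma> (Suc i))" by blast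
  from compliant_limit[of \<sigma> H q f] \<sigma> C
  obtain \<pi> where "\<pi> \<in> strategy_lang H q f" "\<And>i. prefix (length (\<sigma> i)) \<pi> = \<sigma> i"
    "\<And>i. i < length (\<sigma> i)" by (metis subsetD)
  with \<sigma> show ?thesis by blast
qed

section \<open>The nested fixpoint operators\<close>

definition phi4_body ::
    "'q game_graph \<Rightarrow> 'q set \<Rightarrow> 'q set \<Rightarrow> 'q set \<Rightarrow> 'q set \<Rightarrow> 'q set \<Rightarrow> 'q set \<Rightarrow> 'q set" where
  "phi4_body H F\<^sub>A F\<^sub>G Z Y X W =
     (F\<^sub>G \<inter> Pre_sys H Z) \<union> Pre_sys H Y \<union> ((states H - F\<^sub>A) \<inter> CPre H W (X - F\<^sub>A))"

lemma phi4_body_mono: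
  assumes "Z \<subseteq> Z'" "Y \<subseteq> Y'" "X \<subseteq> X'" "W \<subseteq> W'"
  shows "phi4_body H F\<^sub>A F\<^sub>G Z Y X W \<subseteq> phi4_body H F\<^sub>A F\<^sub>G Z' Y' X' W'"
proof -
  have "Pre_sys H P \<subseteq> Pre_sys H P'" "Pre_ex H P \<subseteq> Pre_ex H P'" if "P \<subseteq> P'" for P P'
    using that by (auto simp: Pre_sys_def Pre_ex_def)
  from this(1)[OF assms(1)] this(1)[OF assms(2)] this(2)[OF assms(4)]
       this(1)[of "W \<union> (X - F\<^sub>A)" "W' \<union> (X' - F\<^sub>A)"] assms(3,4)
  show ?thesis unfolding phi4_body_def CPre_def by blast
qed

lemma phi4_lfp_W_mono: "mono (\<lambda>X. lfp (phi4_body H F\<^sub>A F\<^sub>G Z Y X))"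
  by (intro monoI lfp_mono phi4_body_mono) auto

lemma phi4_gfp_X_mono: "mono (\<lambda>Y. gfp (\<lambda>X. lfp (phi4_body H F\<^sub>A F\<^sub>G Z Y X)))"
  by (intro monoI gfp_mono lfp_mono phi4_body_mono) auto

text \<open>The set \<open>P\<close> is left abstract so that it can record where a play has already
  avoided \<open>Y\<close>; it only has to be closed under compliant steps outside \<open>Y\<close>.
  The nonempty extension lets visits to \<open>F\<^sub>A\<close> be iterated.\<close>

lemma strategy_reaches_outside_phi4:
  fixes F\<^sub>G :: "'q set"
  assumes wf: "wf_game_graph H" and strat: "system_strategy H q f"
    and live: "pre (strategy_lang H q f) = pre (strategy_lang H q f \<inter> buchi_lang H q {F\<^sub>A})"
    and Y: "Y = gfp (\<lambda>X. lfp (phi4_body H F\<^sub>A F\<^sub>G Z Y X))"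
    and P: "P \<subseteq> {\<rho> \<in> compliant_prefixes H q f. last \<rho> \<notin> Y}"
    and P_snoc: "\<And>\<rho> t. \<rho> \<in> P \<Longrightarrow> t \<notin> Y \<Longrightarrow> \<rho> @ [t] \<in> compliant_prefixes H q f \<Longrightarrow> \<rho> @ [t] \<in> P"
    and \<rho>: "\<rho> \<in> P"
  shows "\<exists>ys. ys \<noteq> [] \<and> \<rho> @ ys \<in> P \<and> last (\<rho> @ ys) \<in> F\<^sub>A"
proof -
  let ?C = "compliant_prefixes H q f" and ?B = "phi4_body H F\<^sub>A F\<^sub>G Z Y"
  let ?g = "\<lambda>X. lfp (?B X)"
  have Y_fix: "Y = ?g Y"
    using gfp_unfold[OF phi4_lfp_W_mono, of H F\<^sub>A F\<^sub>G Z Y] Y by simp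
  have W_unfold: "?g X = ?B X (?g X)" for X
    by (rule lfp_unfold) (intro monoI phi4_body_mono, auto)
  have Pre_Y: "Pre_sys H Y \<subseteq> Y"
    using W_unfold[of Y] Y_fix by (auto simp: phi4_body_def)
  have W_CPre: "(states H - F\<^sub>A) \<inter> CPre H (?g X) (X - F\<^sub>A) \<subseteq> ?g X" for X
  proof -
    have "(states H - F\<^sub>A) \<inter> CPre H (?g X) (X - F\<^sub>A) \<subseteq> ?B X (?g X)"
      by (auto simp: phi4_body_def)
    then show ?thesis by (simp flip: W_unfold)
  qed
  have PC: "P \<subseteq> ?C" using P by blast
  have step: "\<exists>t. \<rho> @ [t] \<in> P" if \<rho>: "\<rho> \<in> P" for \<rho>
  proof -
    have "\<rho> \<in> ?C" "last \<rho> \<notin> Pre_sys H Y" using \<rho> P Pre_Y by auto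
    then obtain t where "t \<notin> Y" "\<rho> @ [t] \<in> ?C"
      by (rule not_Pre_sys_extend[OF wf strat])
    then show ?thesis using P_snoc \<rho> by blast
  qed
  \<comment> \<open>The conjunct \<open>True\<close> is the trivial \<open>R\<close> of
    \<open>compliant_chain\<close>.\<close>
  have step': "\<exists>ys. ys \<noteq> [] \<and> \<rho> @ ys \<in> P \<and> True" if "\<rho> \<in> P" for \<rho>
    using step[OF that] by blast
  \<comment> \<open>The strategy has memory, so prefixes with the same last state may differ. One
    stuck prefix puts its last state into \<open>B\<close>; hence outside \<open>B\<close> every
    prefix in \<open>P\<close> can still reach \<open>F\<^sub>A\<close>.\<close>
  define B where "B = {last \<rho> | \<rho>. \<rho> \<in> P \<and> (\<forall>ys. \<rho> @ ys \<in> P \<longrightarrow> last (\<rho> @ ys) \<notin> F\<^sub>A)}"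
  have notB: "\<exists>ys. \<rho> @ ys \<in> P \<and> last (\<rho> @ ys) \<in> F\<^sub>A" if "\<rho> \<in> P" "last \<rho> \<notin> B" for \<rho>
    using that unfolding B_def by blast
  \<comment> \<open>This is the premise of coinduction for the greatest fixpoint
    \<open>Y\<close>.\<close>
  have "B \<subseteq> ?g (B \<union> Y)" (is "_ \<subseteq> ?V")
  proof
    fix s assume "s \<in> B"
    then obtain \<rho> where \<rho>: "\<rho> \<in> P" "\<And>ys. \<rho> @ ys \<in> P \<Longrightarrow> last (\<rho> @ ys) \<notin> F\<^sub>A" and s: "s = last \<rho>"
      unfolding B_def by blast
    have YV: "Y \<subseteq> ?V"
      using monoD[OF phi4_lfp_W_mono, of Y "B \<union> Y" H F\<^sub>A F\<^sub>G Z Y] Y_fix by auto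
    show "s \<in> ?V"
    proof (rule ccontr)
      assume "s \<notin> ?V"
      \<comment> \<open>(ii) speaks only of prefixes of infinite plays, so \<open>\<rho>\<close>
        must first be prolonged to one; \<open>P\<close> has no dead ends by
        \<open>step\<close>.\<close>
      obtain \<pi>\<^sub>0 and \<sigma> :: "nat \<Rightarrow> 'q list"
        where "\<pi>\<^sub>0 \<in> strategy_lang H q f" "\<sigma> 0 = \<rho>" "\<And>i. prefix (length (\<sigma> i)) \<pi>\<^sub>0 = \<sigma> i"
        using compliant_chain[where R = "\<lambda>_. True", OF \<rho>(1) PC step'] by blast
      then have "prefix (length \<rho>) \<pi>\<^sub>0 = \<rho>" by metis
      with \<open>\<pi>\<^sub>0 \<in> strategy_lang H q f\<close> have "\<rho> \<in> pre (strategy_lang H q f)"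
        unfolding pre_def by (metis (mono_tags, lifting) mem_Collect_eq)
      then have "\<rho> \<in> pre (strategy_lang H q f \<inter> buchi_lang H q {F\<^sub>A})"
        by (simp only: live)
      then obtain \<pi> n where \<pi>: "\<pi> \<in> strategy_lang H q f" "\<pi> \<in> buchi_lang H q {F\<^sub>A}"
        and n: "\<rho> = prefix n \<pi>"
        unfolding pre_def by blast
      have "n \<noteq> 0"
        using \<rho>(1) P n by (auto simp: compliant_prefixes_def play_prefixes_def)
      then obtain m where m: "n = Suc m" by (cases n) auto
      \<comment> \<open>Index \<open>m\<close> is the last position of \<open>\<rho>\<close>, so the
        induction starts at \<open>s\<close> itself, outside \<open>?V\<close>.\<close>
      have inv: "prefix (Suc (m + d)) \<pi> \<in> P \<and> \<pi> (m + d) \<notin> ?V \<and>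
          (\<exists>ys. prefix (Suc (m + d)) \<pi> = \<rho> @ ys)" for d
      proof (induction d)
        case 0
        then show ?case using \<rho>(1) n m s \<open>s \<notin> ?V\<close> by simp
      next
        case (Suc d)
        let ?\<rho> = "prefix (Suc (m + d)) \<pi>" and ?t = "\<pi> (m + d)" and ?u = "\<pi> (Suc (m + d))"
        obtain ys where ys: "?\<rho> = \<rho> @ ys" using Suc by blast
        have last: "last ?\<rho> = ?t" by simp
        have C: "?\<rho> \<in> ?C" by (rule strategy_lang_prefix[OF \<pi>(1)])
        have noA: "last (?\<rho> @ zs) \<notin> F\<^sub>A" if "?\<rho> @ zs \<in> P" for zs
          using \<rho>(2)[of "ys @ zs"] that ys by simp
        then have "?t \<notin> F\<^sub>A" using noA[of "[]"] Suc last by auto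
        moreover have "?t \<in> states H" using compliant_prefixes_last[OF C] last by simp
        ultimately have "?t \<notin> CPre H ?V ((B \<union> Y) - F\<^sub>A)"
          using Suc W_CPre[of "B \<union> Y"] by blast
        then consider "?t \<notin> Pre_ex H ?V" | "?t \<notin> Pre_sys H (?V \<union> ((B \<union> Y) - F\<^sub>A))"
          unfolding CPre_def by blast
        then have "?u \<notin> ?V"
        proof cases
          case 1
          moreover have "edge H ?t ?u"
            using \<pi>(1) by (auto simp: strategy_lang_def plays_def)
          ultimately show ?thesis by (auto simp: Pre_ex_def edge_def)
        next
          case 2
          \<comment> \<open>This case is contradictory: the environment has a move to some
            \<open>t\<close> that lies in \<open>F\<^sub>A\<close> or outside \<open>B\<close>.
            Either way an extension of \<open>\<rho>\<close> in \<open>P\<close> reaches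
            \<open>F\<^sub>A\<close>.\<close>
          then have "last ?\<rho> \<notin> Pre_sys H (?V \<union> ((B \<union> Y) - F\<^sub>A))" unfolding last .
          then obtain t where t: "t \<notin> ?V \<union> ((B \<union> Y) - F\<^sub>A)" "?\<rho> @ [t] \<in> ?C"
            by (rule not_Pre_sys_extend[OF wf strat C])
          then have tP: "?\<rho> @ [t] \<in> P" using P_snoc Suc YV by blast
          then have "t \<notin> F\<^sub>A" using noA[of "[t]"] by simp
          with t have "t \<notin> B" by blast
          then have "\<exists>zs. ?\<rho> @ [t] @ zs \<in> P \<and> last (?\<rho> @ [t] @ zs) \<in> F\<^sub>A"
            using notB[OF tP] by simp
          with noA have False by blast
          then show ?thesis ..
        qed
        moreover from this have "?\<rho> @ [?u] \<in> P"
          using P_snoc[of ?\<rho> ?u] Suc YV strategy_lang_prefix[OF \<pi>(1), of "Suc (m + d)"] by auto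
        moreover have "prefix (Suc (m + Suc d)) \<pi> = ?\<rho> @ [?u]" by simp
        ultimately show ?case using ys by (metis add_Suc_right append.assoc)
      qed
      have "\<pi> (m + d) \<notin> F\<^sub>A" for d
      proof -
        obtain ys where "prefix (Suc (m + d)) \<pi> = \<rho> @ ys" "prefix (Suc (m + d)) \<pi> \<in> P"
          using inv by blast
        then have "last (prefix (Suc (m + d)) \<pi>) \<notin> F\<^sub>A" using \<rho>(2) by metis
        then show ?thesis by simp
      qed
      moreover obtain k where "k \<ge> m" "\<pi> k \<in> F\<^sub>A"
        using \<pi>(2) by (auto simp: buchi_lang_def INFM_nat_le)
      ultimately show False by (metis le_Suc_ex)
    qed
  qed
  then have "B \<subseteq> Y"
    using coinduct_set[OF phi4_lfp_W_mono, of _ B H F\<^sub>A F\<^sub>G Z Y] Y by auto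
  moreover have "B \<inter> Y = {}" using P unfolding B_def by blast
  ultimately have "B = {}" by blast
  \<comment> \<open>One step is taken first because \<open>notB\<close> may return the empty
    extension.\<close>
  obtain t where t: "\<rho> @ [t] \<in> P" using step \<rho> by blast
  with \<open>B = {}\<close> obtain ys where "\<rho> @ [t] @ ys \<in> P" "last (\<rho> @ [t] @ ys) \<in> F\<^sub>A"
    using notB[OF t] by auto
  then show ?thesis by (intro exI[of _ "[t] @ ys"]) auto
qed

section \<open>Contradiction between (i), (ii) and a state outside the formula\<close>

theorem theorem2:
  fixes H :: "'q game_graph" and F\<^sub>A F\<^sub>G :: "'q set" and q :: 'q and f :: "'q list \<Rightarrow> 'q"
  assumes "wf_game_graph H"
    and "F\<^sub>A \<subseteq> states H" and "F\<^sub>G \<subseteq> states H"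
    and "q \<in> states H - phi4 H F\<^sub>A F\<^sub>G"
    and "system_strategy H q f"
  shows "\<not> (strategy_lang H q f \<noteq> {} \<and>
            strategy_lang H q f \<subseteq> (omega_words H - buchi_lang H q {F\<^sub>A}) \<union> buchi_lang H q {F\<^sub>G}) \<or>
         \<not> (pre (strategy_lang H q f) = pre (strategy_lang H q f \<inter> buchi_lang H q {F\<^sub>A}))"
proof (rule ccontr)
  assume "\<not> ?thesis"
  then have safe: "strategy_lang H q f \<subseteq>
        (omega_words H - buchi_lang H q {F\<^sub>A}) \<union> buchi_lang H q {F\<^sub>G}"
    and live: "pre (strategy_lang H q f) = pre (strategy_lang H q f \<inter> buchi_lang H q {F\<^sub>A})"
    by auto
  let ?C = "compliant_prefixes H q f"
  define N where "N = last ` ?C"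
  define Y where "Y = lfp (\<lambda>Y. gfp (\<lambda>X. lfp (phi4_body H F\<^sub>A F\<^sub>G N Y X)))"
  have Y_fix: "Y = gfp (\<lambda>X. lfp (phi4_body H F\<^sub>A F\<^sub>G N Y X))"
    unfolding Y_def by (rule lfp_unfold[OF phi4_gfp_X_mono])
  have Y_lfp: "Y = lfp (phi4_body H F\<^sub>A F\<^sub>G N Y Y)"
    using gfp_unfold[OF phi4_lfp_W_mono, of H F\<^sub>A F\<^sub>G N Y] Y_fix by simp
  \<comment> \<open>At the fixpoint the variables \<open>Y\<close>, \<open>X\<close> and
    \<open>W\<close> all take the value \<open>Y\<close>.\<close>
  have "Y = phi4_body H F\<^sub>A F\<^sub>G N Y Y Y"
    using lfp_unfold[of "phi4_body H F\<^sub>A F\<^sub>G N Y Y"] Y_lfp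
    by (simp add: monoI phi4_body_mono)
  then have Pre_N: "F\<^sub>G \<inter> Pre_sys H N \<subseteq> Y" by (auto simp: phi4_body_def)
  have noG: "last \<rho> \<notin> F\<^sub>G" if \<rho>: "\<rho> \<in> ?C" "last \<rho> \<notin> Y" for \<rho>
  proof
    assume "last \<rho> \<in> F\<^sub>G"
    then have "last \<rho> \<notin> Pre_sys H N" using Pre_N \<rho> by blast
    \<comment> \<open>A compliant step out of \<open>N\<close> is absurd, as \<open>N\<close>
      collects the ends of all compliant prefixes.\<close>
    then obtain t where "t \<notin> N" "\<rho> @ [t] \<in> ?C"
      using not_Pre_sys_extend[OF assms(1,5) \<rho>(1)] by blast
    then show False unfolding N_def by (metis imageI last_snoc)
  qed
  have "N \<subseteq> Y"
  proof
    fix s assume "s \<in> N"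
    then obtain \<rho> where \<rho>: "\<rho> \<in> ?C" "s = last \<rho>" unfolding N_def by blast
    show "s \<in> Y"
    proof (rule ccontr)
      assume s: "s \<notin> Y"
      \<comment> \<open>The bound \<open>length \<rho> \<le> Suc k\<close> includes the last
        position of \<open>\<rho>\<close>, so \<open>Y\<close> is avoided from \<open>s\<close>
        onwards.\<close>
      define P where "P = {\<rho>' \<in> ?C. length \<rho> \<le> length \<rho>' \<and>
         (\<forall>k. length \<rho> \<le> Suc k \<longrightarrow> k < length \<rho>' \<longrightarrow> \<rho>' ! k \<notin> Y)}"
      have ne: "\<rho>' \<noteq> []" if "\<rho>' \<in> ?C" for \<rho>'
        using that by (auto simp: compliant_prefixes_def play_prefixes_def)
      have "\<rho> ! k \<notin> Y" if "length \<rho> \<le> Suc k" "k < length \<rho>" for k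
      proof -
        have "k = length \<rho> - 1" using that by simp
        then show ?thesis using s \<rho> ne by (metis last_conv_nth)
      qed
      then have "\<rho> \<in> P" using \<rho> by (simp add: P_def)
      have PC: "P \<subseteq> {\<rho>' \<in> ?C. last \<rho>' \<notin> Y}"
        using ne by (auto simp: P_def last_conv_nth)
      have snoc: "\<rho>' @ [t] \<in> P" if "\<rho>' \<in> P" "t \<notin> Y" "\<rho>' @ [t] \<in> ?C" for \<rho>' t
        using that by (auto simp: P_def nth_append)
      have PC': "P \<subseteq> ?C" using PC by blast
      note reach = strategy_reaches_outside_phi4[OF assms(1,5) live Y_fix PC snoc]
      obtain \<pi> \<sigma> where \<pi>: "\<pi> \<in> strategy_lang H q f"
        and \<sigma>: "\<And>i. \<sigma> i \<in> P" "\<And>i. last (\<sigma> (Suc i)) \<in> F\<^sub>A"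
          "\<And>i. prefix (length (\<sigma> i)) \<pi> = \<sigma> i" "\<And>i. i < length (\<sigma> i)"
        using compliant_chain[where R = "\<lambda>\<rho>. last \<rho> \<in> F\<^sub>A", OF \<open>\<rho> \<in> P\<close> PC' reach] by blast
      have "\<exists>k\<ge>i. \<pi> k \<in> F\<^sub>A" for i
      proof (intro exI conjI)
        have len: "Suc i < length (\<sigma> (Suc i))" using \<sigma>(4)[of "Suc i"] .
        then show "i \<le> length (\<sigma> (Suc i)) - 1" by simp
        have "last (\<sigma> (Suc i)) = prefix (length (\<sigma> (Suc i))) \<pi> ! (length (\<sigma> (Suc i)) - 1)"
          using len \<sigma>(3)[of "Suc i"] by (metis last_conv_nth list.size(3) not_less_zero)
        also have "\<dots> = \<pi> (length (\<sigma> (Suc i)) - 1)" using len by simp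
        finally show "\<pi> (length (\<sigma> (Suc i)) - 1) \<in> F\<^sub>A" using \<sigma>(2)[of i] by simp
      qed
      with \<pi> have "\<pi> \<in> buchi_lang H q {F\<^sub>A}"
        by (auto simp: buchi_lang_def strategy_lang_def INFM_nat_le)
      with \<pi> safe have "\<pi> \<in> buchi_lang H q {F\<^sub>G}" by blast
      \<comment> \<open>A visit to \<open>F\<^sub>G\<close> this late falls into the part avoiding
        \<open>Y\<close>: position \<open>k\<close> lies within \<open>\<sigma> k\<close>, a member
        of \<open>P\<close>. This contradicts \<open>noG\<close>.\<close>
      then obtain k where k: "k \<ge> length \<rho>" "\<pi> k \<in> F\<^sub>G"
        by (auto simp: buchi_lang_def INFM_nat_le)
      have "\<pi> k = prefix (length (\<sigma> k)) \<pi> ! k" using \<sigma>(4)[of k] by simp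
      then have "\<pi> k = \<sigma> k ! k" unfolding \<sigma>(3) .
      then have "\<pi> k \<notin> Y" using \<sigma>(1)[of k] \<sigma>(4)[of k] k(1) by (auto simp: P_def)
      with noG[OF strategy_lang_prefix[OF \<pi>, of k]] k(2) show False by simp
    qed
  qed
  \<comment> \<open>\<open>N \<subseteq> Y\<close> says that \<open>N\<close> is a post-fixpoint of
    the outermost operator, since \<open>Y\<close> is its value at \<open>N\<close>.\<close>
  then have "N \<subseteq> phi4 H F\<^sub>A F\<^sub>G"
    unfolding phi4_def Y_def phi4_body_def by (rule gfp_upperbound)
  moreover have "[q] \<in> ?C"
    using assms(4) by (auto simp: compliant_prefixes_def play_prefixes_def)
  then have "q \<in> N" unfolding N_def by force
  ultimately show False using assms(4) by blast
qed

end
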